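(* Let $\pi$ be the Poisson structure on $\mathbb{R}^5$ with coordinates $(x_1,y_1,x_2,y_2,z)$ given by the matrix $$\pi=\left[\begin{array}{ccccc}0&1&0&0&0\\-1&0&0&0&x_1\\0&0&0&1&0\\0&0&-1&0&x_2\\0&-x_1&0&-x_2&0\end{array}\right],$$ let $H=\frac12(y_1^2+y_2^2+z^2)$, and let $X_H=\pi\nabla H=(y_1,\,x_1z,\,y_2,\,x_2z,\,-x_1y_1-x_2y_2)$. Then the Hamilton-Poisson mechanical system $(\mathbb{R}^5,\pi,X_H)$ has a full symplectic realization $(T^*\mathbb{R}^3\simeq\mathbb{R}^6,\omega,X_{\tilde H})$, where $\omega$ is the canonical symplectic form $$\omega=dp_1\wedge dq_1+dp_2\wedge dq_2+dp_3\wedge dq_3,$$ the Hamiltonian is $$\tilde H=\frac12p_1^2+\frac12p_2^2+\frac12\left[p_3-\frac12(q_1^2+q_2^2)\right]^2,$$ and the corresponding Hamiltonian vector field is $$X_{\tilde H}=p_1\frac{\partial}{\partial q_1}+p_2\frac{\partial}{\partial q_2}+\left[p_3-\frac12(q_1^2+q_2^2)\right]\frac{\partial}{\partial q_3}+\left[q_1p_3-\frac12q_1^3-\frac12q_1q_2^2\right]\frac{\partial}{\partial p_1}+\left[q_2p_3-\frac12q_1^2q_2-\frac12q_2^3\right]\frac{\partial}{\partial p_2}.$$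
   Context: Coordinates on $T^*\mathbb{R}^3\simeq\mathbb{R}^6$ are $(q_1,q_2,q_3,p_1,p_2,p_3)$. The sign convention is such that the Hamiltonian vector field of $\tilde H$ with respect to $\omega$ gives Hamilton's equations $\dot q_i=\partial\tilde H/\partial p_i$, $\dot p_i=-\partial\tilde H/\partial q_i$, and the Poisson bracket $\{\cdot,\cdot\}_\omega$ induced by $\omega$ is the canonical one, with $\{q_i,p_j\}_\omega=\delta_{ij}$, $\{q_i,q_j\}_\omega=\{p_i,p_j\}_\omega=0$. The matrix entry $\pi_{ij}$ is the bracket $\{u_i,u_j\}$ of the coordinate functions $(u_1,\dots,u_5)=(x_1,y_1,x_2,y_2,z)$. That $(\mathbb{R}^6,\omega,X_{\tilde H})$ is a full symplectic realization of $(\mathbb{R}^5,\pi,X_H)$ means that there is a surjective submersion $\varphi:\mathbb{R}^6\to\mathbb{R}^5$ that is a Poisson map from $(\mathbb{R}^6,\{\cdot,\cdot\}_\omega)$ to $(\mathbb{R}^5,\pi)$ (i.e. $\{f\circ\varphi,g\circ\varphi\}_\omega=\{f,g\}_\pi\circ\varphi$ for all smooth $f,g$ on $\mathbb{R}^5$) and that maps $X_{\tilde H}$ onto $X_H$ (i.e. $d\varphi(X_{\tilde H})=X_H\circ\varphi$). *)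

theory Defs
  imports "HOL-Analysis.Analysis"
begin

section \<open>Smooth maps and differentials\<close>

definition differential ::
  "('a::real_normed_vector \<Rightarrow> 'b::real_normed_vector) \<Rightarrow> 'a \<Rightarrow> 'a \<Rightarrow> 'b" where
  "differential f x = frechet_derivative f (at x)"

text \<open>On a finite-dimensional domain, continuity of all directional derivatives up to order \<open>k\<close>
  is the usual \<open>k\<close>-fold continuous differentiability.\<close>

primrec Ck_map :: "nat \<Rightarrow> ('a::euclidean_space \<Rightarrow> 'b::real_normed_vector) \<Rightarrow> bool" where
  "Ck_map 0 f \<longleftrightarrow> continuous_on UNIV f"
| "Ck_map (Suc k) f \<longleftrightarrow>
    (\<forall>x. f differentiable (at x)) \<and> (\<forall>v. Ck_map k (\<lambda>x. differential f x v))"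

definition smooth_map :: "('a::euclidean_space \<Rightarrow> 'b::real_normed_vector) \<Rightarrow> bool" where
  "smooth_map f \<longleftrightarrow> (\<forall>k. Ck_map k f)"

definition submersion :: "('a::euclidean_space \<Rightarrow> 'b::real_normed_vector) \<Rightarrow> bool" where
  "submersion f \<longleftrightarrow> smooth_map f \<and> (\<forall>x. surj (differential f x))"

section \<open>Poisson structures on \<open>\<real>\<^sup>n\<close>\<close>

definition gradient :: "(real^'n \<Rightarrow> real) \<Rightarrow> real^'n \<Rightarrow> real^'n" where
  "gradient f x = (\<chi> i. differential f x (axis i 1))"

text \<open>The bracket with \<open>{u\<^sub>i, u\<^sub>j} = \<pi>\<^sub>i\<^sub>j\<close> for the coordinate functions \<open>u\<^sub>i\<close>, that is,
  \<open>{f, g} = \<Sum>\<^sub>i\<^sub>j \<pi>\<^sub>i\<^sub>j (\<partial>f/\<partial>u\<^sub>i) (\<partial>g/\<partial>u\<^sub>j)\<close>.\<close>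

definition poisson_bracket ::
  "(real^'n \<Rightarrow> real^'n^'n) \<Rightarrow> (real^'n \<Rightarrow> real) \<Rightarrow> (real^'n \<Rightarrow> real) \<Rightarrow> real^'n \<Rightarrow> real" where
  "poisson_bracket \<pi> f g u = gradient f u \<bullet> (\<pi> u *v gradient g u)"

text \<open>Bilinearity and the Leibniz rule hold for every matrix-valued \<open>\<pi>\<close>.\<close>

definition poisson_structure :: "(real^'n \<Rightarrow> real^'n^'n) \<Rightarrow> bool" where
  "poisson_structure \<pi> \<longleftrightarrow>
    smooth_map \<pi> \<and>
    (\<forall>u. transpose (\<pi> u) = - \<pi> u) \<and>
    (\<forall>f g h. smooth_map f \<longrightarrow> smooth_map g \<longrightarrow> smooth_map h \<longrightarrow>
      (\<forall>u. poisson_bracket \<pi> f (poisson_bracket \<pi> g h) u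
          + poisson_bracket \<pi> g (poisson_bracket \<pi> h f) u
          + poisson_bracket \<pi> h (poisson_bracket \<pi> f g) u = 0))"

definition poisson_vector_field ::
  "(real^'n \<Rightarrow> real^'n^'n) \<Rightarrow> (real^'n \<Rightarrow> real) \<Rightarrow> real^'n \<Rightarrow> real^'n" where
  "poisson_vector_field \<pi> H u = \<pi> u *v gradient H u"

section \<open>Symplectic forms\<close>

type_synonym 'a two_form = "'a \<Rightarrow> 'a \<Rightarrow> 'a \<Rightarrow> real"

definition wedge :: "('a \<Rightarrow> real) \<Rightarrow> ('a \<Rightarrow> real) \<Rightarrow> 'a \<Rightarrow> 'a \<Rightarrow> real" (infixl "\<and>\<^sub>d" 72) where
  "(\<alpha> \<and>\<^sub>d \<beta>) v w = \<alpha> v * \<beta> w - \<alpha> w * \<beta> v"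

definition ext_deriv ::
  "'a::real_normed_vector two_form \<Rightarrow> 'a \<Rightarrow> 'a \<Rightarrow> 'a \<Rightarrow> 'a \<Rightarrow> real" where
  "ext_deriv \<omega> x u v w =
    differential (\<lambda>y. \<omega> y v w) x u
    - differential (\<lambda>y. \<omega> y u w) x v
    + differential (\<lambda>y. \<omega> y u v) x w"

definition symplectic_form :: "'a::euclidean_space two_form \<Rightarrow> bool" where
  "symplectic_form \<omega> \<longleftrightarrow>
    (\<forall>v w. smooth_map (\<lambda>x. \<omega> x v w)) \<and>
    (\<forall>x. bilinear (\<omega> x)) \<and>
    (\<forall>x v. \<omega> x v v = 0) \<and>
    (\<forall>x v. (\<forall>w. \<omega> x v w = 0) \<longrightarrow> v = 0) \<and>
    (\<forall>x u v w. ext_deriv \<omega> x u v w = 0)"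

text \<open>The sign is \<open>\<iota>\<^sub>X \<omega> = - dH\<close>: for \<open>\<omega> = \<Sum>\<^sub>i dp\<^sub>i \<and> dq\<^sub>i\<close> this yields
  \<open>dq\<^sub>i/dt = \<partial>H/\<partial>p\<^sub>i\<close> and \<open>dp\<^sub>i/dt = - \<partial>H/\<partial>q\<^sub>i\<close>. The value is unique when \<open>\<omega>\<close> is nondegenerate
  and is unspecified otherwise.\<close>

definition hamiltonian_vector_field ::
  "'a::euclidean_space two_form \<Rightarrow> ('a \<Rightarrow> real) \<Rightarrow> 'a \<Rightarrow> 'a" where
  "hamiltonian_vector_field \<omega> H x = (THE X. \<forall>v. \<omega> x X v = - differential H x v)"

text \<open>With the sign above, \<open>{f, g} = \<omega>(X\<^sub>g, X\<^sub>f) = df(X\<^sub>g)\<close>, so that \<open>{q\<^sub>i, p\<^sub>j} = \<delta>\<^sub>i\<^sub>j\<close> in the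
  canonical case.\<close>

definition symplectic_bracket ::
  "'a::euclidean_space two_form \<Rightarrow> ('a \<Rightarrow> real) \<Rightarrow> ('a \<Rightarrow> real) \<Rightarrow> 'a \<Rightarrow> real" where
  "symplectic_bracket \<omega> f g x =
    \<omega> x (hamiltonian_vector_field \<omega> g x) (hamiltonian_vector_field \<omega> f x)"

text \<open>Points of \<open>T\<^sup>*\<real>\<^sup>3\<close> are vectors \<open>(q\<^sub>1, q\<^sub>2, q\<^sub>3, p\<^sub>1, p\<^sub>2, p\<^sub>3)\<close>.\<close>

definition canonical_form :: "(real^6) two_form" where
  "canonical_form x =
    (let q1 = (\<lambda>y. y $ 1); q2 = (\<lambda>y. y $ 2); q3 = (\<lambda>y. y $ 3);
         p1 = (\<lambda>y. y $ 4); p2 = (\<lambda>y. y $ 5); p3 = (\<lambda>y. y $ 6)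
     in (\<lambda>v w. (differential p1 x \<and>\<^sub>d differential q1 x) v w
             + (differential p2 x \<and>\<^sub>d differential q2 x) v w
             + (differential p3 x \<and>\<^sub>d differential q3 x) v w))"

section \<open>Symplectic realizations\<close>

definition full_symplectic_realization ::
  "(real^'m) two_form \<Rightarrow> (real^'m \<Rightarrow> real^'m) \<Rightarrow>
   (real^'n \<Rightarrow> real^'n^'n) \<Rightarrow> (real^'n \<Rightarrow> real^'n) \<Rightarrow> bool" where
  "full_symplectic_realization \<omega> Y \<pi> X \<longleftrightarrow>
    symplectic_form \<omega> \<and> poisson_structure \<pi> \<and>
    (\<exists>\<phi>. submersion \<phi> \<and> surj \<phi> \<and>
      (\<forall>f g. smooth_map f \<longrightarrow> smooth_map g \<longrightarrow>
        symplectic_bracket \<omega> (f \<circ> \<phi>) (g \<circ> \<phi>) = poisson_bracket \<pi> f g \<circ> \<phi>) \<and>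
      (\<forall>x. differential \<phi> x (Y x) = X (\<phi> x)))"

end

theory Submission
  imports Defs
begin

text \<open>The realization is
  \<open>\<phi>(q, p) = (q\<^sub>1, p\<^sub>1, q\<^sub>2, p\<^sub>2, p\<^sub>3 - (q\<^sub>1\<^sup>2 + q\<^sub>2\<^sup>2)/2)\<close>. It is read off from the brackets: \<open>\<pi>\<close> makes
  \<open>(x\<^sub>1, y\<^sub>1)\<close> and \<open>(x\<^sub>2, y\<^sub>2)\<close> canonical pairs, and \<open>z\<close> satisfies \<open>{y\<^sub>i, z} = x\<^sub>i\<close> and commutes with
  the \<open>x\<^sub>i\<close>. In \<open>T\<^sup>*\<real>\<^sup>3\<close> the function \<open>-(q\<^sub>1\<^sup>2 + q\<^sub>2\<^sup>2)/2\<close> has exactly these brackets, and adding the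
  momentum \<open>p\<^sub>3\<close>, which commutes with \<open>q\<^sub>1, q\<^sub>2, p\<^sub>1, p\<^sub>2\<close>, restores independence of the five components.
  Moreover the Hamiltonian on \<open>T\<^sup>*\<real>\<^sup>3\<close> is the pullback of \<open>H\<close> under \<open>\<phi>\<close>.

  Everything about \<open>\<phi>\<close> rests on one identity, \<open>realization_map_hamiltonian\<close>: for every differentiable
  \<open>f\<close>, the differential of \<open>\<phi>\<close> carries the canonical Hamiltonian vector field of \<open>f \<circ> \<phi>\<close> to the field
  \<open>\<pi> \<nabla>f\<close>. Applied to \<open>H\<close> it relates the two dynamics. Combined with \<open>{F, G} = dF(X\<^sub>G)\<close>
  it shows that \<open>\<phi>\<close> is a Poisson map.

  The Jacobi identity for \<open>\<pi>\<close> follows from \<open>poisson_structureI\<close>. Expanding a double bracket gives terms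
  with second derivatives of the functions and terms with derivatives of \<open>\<pi>\<close>. The former cancel in the
  cyclic sum because \<open>\<pi>\<close> is skew and Hessians are symmetric; the latter involve only the gradients at
  the point and vanish for the given \<open>\<pi>\<close> by direct computation. Symmetry of the Hessian
  (\<open>second_differential_commute\<close>) comes from a mean value argument on second differences.\<close>

section \<open>Vectors with five and six components\<close>

lemma exhaust_5: fixes x :: 5 shows "x = 1 \<or> x = 2 \<or> x = 3 \<or> x = 4 \<or> x = 5"
proof (induct x)
  case (of_int z)
  then have "z = 0 \<or> z = 1 \<or> z = 2 \<or> z = 3 \<or> z = 4" by fastforce
  then show ?case by auto
qed

lemma exhaust_6: fixes x :: 6 shows "x = 1 \<or> x = 2 \<or> x = 3 \<or> x = 4 \<or> x = 5 \<or> x = 6"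
proof (induct x)
  case (of_int z)
  then have "z = 0 \<or> z = 1 \<or> z = 2 \<or> z = 3 \<or> z = 4 \<or> z = 5" by fastforce
  then show ?case by auto
qed

lemma forall_5: "(\<forall>i::5. P i) \<longleftrightarrow> P 1 \<and> P 2 \<and> P 3 \<and> P 4 \<and> P 5"
  by (metis exhaust_5)

lemma forall_6: "(\<forall>i::6. P i) \<longleftrightarrow> P 1 \<and> P 2 \<and> P 3 \<and> P 4 \<and> P 5 \<and> P 6"
  by (metis exhaust_6)

lemma sum_5: "sum f (UNIV::5 set) = f 1 + f 2 + f 3 + f 4 + f 5"
proof -
  have U: "UNIV = {1, 2, 3, 4, 5::5}" using exhaust_5 by auto
  show ?thesis unfolding U by (simp add: ac_simps)
qed

lemma sum_6: "sum f (UNIV::6 set) = f 1 + f 2 + f 3 + f 4 + f 5 + f 6"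
proof -
  have U: "UNIV = {1, 2, 3, 4, 5, 6::6}" using exhaust_6 by auto
  show ?thesis unfolding U by (simp add: ac_simps)
qed

lemma vector_5 [simp]:
  "(vector [a, b, c, d, e] :: 'a::zero^5) $ 1 = a"
  "(vector [a, b, c, d, e] :: 'a::zero^5) $ 2 = b"
  "(vector [a, b, c, d, e] :: 'a::zero^5) $ 3 = c"
  "(vector [a, b, c, d, e] :: 'a::zero^5) $ 4 = d"
  "(vector [a, b, c, d, e] :: 'a::zero^5) $ 5 = e"
  unfolding vector_def by simp_all

lemma vector_6 [simp]:
  "(vector [a, b, c, d, e, f] :: 'a::zero^6) $ 1 = a"
  "(vector [a, b, c, d, e, f] :: 'a::zero^6) $ 2 = b"
  "(vector [a, b, c, d, e, f] :: 'a::zero^6) $ 3 = c"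
  "(vector [a, b, c, d, e, f] :: 'a::zero^6) $ 4 = d"
  "(vector [a, b, c, d, e, f] :: 'a::zero^6) $ 5 = e"
  "(vector [a, b, c, d, e, f] :: 'a::zero^6) $ 6 = f"
  unfolding vector_def by simp_all

section \<open>Differentials and smooth maps\<close>

lemma differential_eqI: "(f has_derivative f') (at x) \<Longrightarrow> differential f x = f'"
  unfolding differential_def by (rule frechet_derivative_at[symmetric])

lemma has_derivative_differential:
  "f differentiable (at x) \<Longrightarrow> (f has_derivative differential f x) (at x)"
  unfolding differential_def by (simp add: frechet_derivative_works)

lemma smooth_map_differentiable: "smooth_map f \<Longrightarrow> f differentiable (at x)"
  unfolding smooth_map_def by (metis Ck_map.simps(2))

lemma smooth_map_differential: "smooth_map f \<Longrightarrow> smooth_map (\<lambda>x. differential f x v)"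
  unfolding smooth_map_def by (metis Ck_map.simps(2))

lemma smooth_map_isCont: "smooth_map f \<Longrightarrow> isCont f x"
  by (simp add: smooth_map_differentiable differentiable_imp_continuous_within)

text \<open>Smoothness asks for the iterated directional derivatives to exist, so it suffices to know it for the
  first ones. For a polynomial map this reaches constants after finitely many steps.\<close>

lemma smooth_mapI:
  assumes "\<And>x. (f has_derivative f' x) (at x)" and "\<And>v. smooth_map (\<lambda>x. f' x v)"
  shows "smooth_map f"
proof -
  have "Ck_map k f" for k
  proof (cases k)
    case 0
    then show ?thesis using assms(1)
      by (auto intro!: continuous_at_imp_continuous_on has_derivative_continuous)
  next
    case (Suc n)
    have "differential f x = f' x" for x
      using assms(1) by (rule differential_eqI)
    then show ?thesis using assms Suc by (auto simp: smooth_map_def differentiable_def)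
  qed
  then show ?thesis by (simp add: smooth_map_def)
qed

lemma smooth_map_const: "smooth_map (\<lambda>x. c)"
proof -
  have "Ck_map k (\<lambda>x::'a. c::'b)" for k c
    by (induction k arbitrary: c) (auto simp: differential_eqI[OF has_derivative_const])
  then show ?thesis by (simp add: smooth_map_def)
qed

lemma has_derivative_vecI:
  fixes f :: "'a::real_normed_vector \<Rightarrow> 'b::euclidean_space^'n"
  assumes "\<And>i. ((\<lambda>x. f x $ i) has_derivative (\<lambda>v. f' v $ i)) (at x)"
  shows "(f has_derivative f') (at x)"
proof (subst has_derivative_componentwise_within, intro ballI)
  fix e :: "'b^'n" assume "e \<in> Basis"
  then obtain i b where "e = axis i b" by (auto simp: Basis_vec_def)
  then show "((\<lambda>x. f x \<bullet> e) has_derivative (\<lambda>v. f' v \<bullet> e)) (at x)"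
    using assms[of i] by (auto simp: inner_axis intro: has_derivative_inner_left)
qed

lemma has_derivative_vector_5:
  fixes a b c d e :: "'a::real_normed_vector \<Rightarrow> 'b::euclidean_space"
  assumes "(a has_derivative a') (at x)" "(b has_derivative b') (at x)" "(c has_derivative c') (at x)"
    "(d has_derivative d') (at x)" "(e has_derivative e') (at x)"
  shows "((\<lambda>x. vector [a x, b x, c x, d x, e x] :: 'b^5) has_derivative
    (\<lambda>v. vector [a' v, b' v, c' v, d' v, e' v])) (at x)"
proof (rule has_derivative_vecI)
  have "\<forall>i. ((\<lambda>x. (vector [a x, b x, c x, d x, e x] :: 'b^5) $ i) has_derivative
    (\<lambda>v. (vector [a' v, b' v, c' v, d' v, e' v] :: 'b^5) $ i)) (at x)"
    by (simp add: forall_5 assms)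
  then show "((\<lambda>x. (vector [a x, b x, c x, d x, e x] :: 'b^5) $ i) has_derivative
    (\<lambda>v. (vector [a' v, b' v, c' v, d' v, e' v] :: 'b^5) $ i)) (at x)" for i ..
qed

lemma has_derivative_vec_nth: "((\<lambda>x. x $ i) has_derivative (\<lambda>v. v $ i)) (at x)"
  by (intro bounded_linear_imp_has_derivative bounded_linear_vec_nth)

section \<open>Symmetry of second derivatives\<close>

text \<open>The second difference over a parallelogram is a difference along \<open>v\<close> of differences along \<open>w\<close>; the
  mean value theorem in the first direction and then in the second turns it into a second derivative at
  an interior point.\<close>

lemma second_difference_mean_value:
  fixes f :: "'a::real_normed_vector \<Rightarrow> real"
  assumes f: "\<And>x. f differentiable (at x)"
    and fv: "\<And>x. (\<lambda>y. differential f y v) differentiable (at x)"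
    and h: "h > 0"
  shows "\<exists>s\<in>{0<..<h}. \<exists>t\<in>{0<..<h}.
    f (x + h *\<^sub>R v + h *\<^sub>R w) - f (x + h *\<^sub>R v) - f (x + h *\<^sub>R w) + f x
      = h\<^sup>2 * differential (\<lambda>y. differential f y v) (x + s *\<^sub>R v + t *\<^sub>R w) w"
proof -
  have line: "((\<lambda>t. g (y + t *\<^sub>R u)) has_derivative (\<lambda>r. r * differential g (y + t *\<^sub>R u) u)) (at t within A)"
    if "\<And>x. g differentiable (at x)" for g :: "'a \<Rightarrow> real" and y u t A
  proof -
    have g: "(g has_derivative differential g (y + t *\<^sub>R u)) (at (y + t *\<^sub>R u))"
      using that by (rule has_derivative_differential)
    have "((\<lambda>t. y + t *\<^sub>R u) has_derivative (\<lambda>r. r *\<^sub>R u)) (at t within A)"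
      by (auto intro!: derivative_eq_intros)
    from has_derivative_compose[OF this g] show ?thesis
      using linear_cmul[OF has_derivative_linear[OF g]] by simp
  qed
  \<comment> \<open>Two opposite edges in direction \<open>v\<close>, which differ by the translation \<open>h w\<close>.\<close>
  let ?\<phi> = "\<lambda>s. f ((x + h *\<^sub>R w) + s *\<^sub>R v) - f (x + s *\<^sub>R v)"
  obtain s where s: "s \<in> {0<..<h}" and
    1: "?\<phi> h - ?\<phi> 0 = h * differential f ((x + h *\<^sub>R w) + s *\<^sub>R v) v - h * differential f (x + s *\<^sub>R v) v"
    using mvt_simple[OF h, of ?\<phi> "\<lambda>s r. r * differential f ((x + h *\<^sub>R w) + s *\<^sub>R v) v - r * differential f (x + s *\<^sub>R v) v"]
      has_derivative_diff[OF line line, OF f f] by fastforce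
  let ?\<psi> = "\<lambda>t. differential f ((x + s *\<^sub>R v) + t *\<^sub>R w) v"
  obtain t where t: "t \<in> {0<..<h}" and
    2: "?\<psi> h - ?\<psi> 0 = h * differential (\<lambda>y. differential f y v) ((x + s *\<^sub>R v) + t *\<^sub>R w) w"
    using mvt_simple[OF h, of ?\<psi>, OF line, OF fv] by fastforce
  have "f (x + h *\<^sub>R v + h *\<^sub>R w) - f (x + h *\<^sub>R v) - f (x + h *\<^sub>R w) + f x = h * (?\<psi> h - ?\<psi> 0)"
    using 1 by (simp add: algebra_simps)
  then have "f (x + h *\<^sub>R v + h *\<^sub>R w) - f (x + h *\<^sub>R v) - f (x + h *\<^sub>R w) + f x
      = h\<^sup>2 * differential (\<lambda>y. differential f y v) (x + s *\<^sub>R v + t *\<^sub>R w) w"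
    by (simp only: 2 power2_eq_square mult.assoc)
  then show ?thesis using s t by blast
qed

text \<open>The intermediate points \<open>Y h\<close> given by the mean value theorem are squeezed towards \<open>x\<close>.\<close>

lemma second_difference_quotient_tendsto:
  fixes f :: "'a::real_normed_vector \<Rightarrow> real"
  assumes f: "\<And>x. f differentiable (at x)"
    and fv: "\<And>x. (\<lambda>y. differential f y v) differentiable (at x)"
    and cont: "isCont (\<lambda>y. differential (\<lambda>y. differential f y v) y w) x"
  shows "((\<lambda>h. (f (x + h *\<^sub>R v + h *\<^sub>R w) - f (x + h *\<^sub>R v) - f (x + h *\<^sub>R w) + f x) / h\<^sup>2)
    \<longlongrightarrow> differential (\<lambda>y. differential f y v) x w) (at_right 0)"
proof -
  let ?D = "\<lambda>y. differential (\<lambda>y. differential f y v) y w"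
  have "\<forall>h\<in>{0<..}. \<exists>y. \<exists>s\<in>{0<..<h}. \<exists>t\<in>{0<..<h}. y = x + s *\<^sub>R v + t *\<^sub>R w \<and>
      f (x + h *\<^sub>R v + h *\<^sub>R w) - f (x + h *\<^sub>R v) - f (x + h *\<^sub>R w) + f x = h\<^sup>2 * ?D y"
    using second_difference_mean_value[OF f fv, of _ x w] by fastforce
  then obtain Y where Y: "\<And>h. h > 0 \<Longrightarrow> \<exists>s\<in>{0<..<h}. \<exists>t\<in>{0<..<h}. Y h = x + s *\<^sub>R v + t *\<^sub>R w \<and>
      f (x + h *\<^sub>R v + h *\<^sub>R w) - f (x + h *\<^sub>R v) - f (x + h *\<^sub>R w) + f x = h\<^sup>2 * ?D (Y h)"
    unfolding bchoice_iff by (metis greaterThan_iff)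
  have bound: "norm (Y h - x) \<le> h * (norm v + norm w)" if h: "h > 0" for h
  proof -
    obtain s t where st: "0 < s" "s < h" "0 < t" "t < h" and "Y h = x + s *\<^sub>R v + t *\<^sub>R w"
      using Y[OF h] by auto
    then have "norm (Y h - x) \<le> s * norm v + t * norm w"
      using norm_triangle_ineq[of "s *\<^sub>R v" "t *\<^sub>R w"] by simp
    also have "\<dots> \<le> h * norm v + h * norm w"
      using st by (intro add_mono mult_right_mono) auto
    finally show ?thesis by (simp add: algebra_simps)
  qed
  have "((\<lambda>h::real. h * (norm v + norm w)) \<longlongrightarrow> 0) (at_right 0)"
    by (auto intro!: tendsto_eq_intros)
  then have "((\<lambda>h. Y h - x) \<longlongrightarrow> 0) (at_right 0)"
    by (rule Lim_null_comparison[rotated])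
       (use bound in \<open>auto simp: eventually_at_right_less intro: eventually_mono[OF eventually_at_right_less]\<close>)
  then have "(Y \<longlongrightarrow> x) (at_right 0)"
    by (simp add: LIM_zero_iff)
  then have "((\<lambda>h. ?D (Y h)) \<longlongrightarrow> ?D x) (at_right 0)"
    using isCont_tendsto_compose[OF cont] by blast
  moreover have "\<forall>\<^sub>F h in at_right 0. ?D (Y h) =
      (f (x + h *\<^sub>R v + h *\<^sub>R w) - f (x + h *\<^sub>R v) - f (x + h *\<^sub>R w) + f x) / h\<^sup>2"
    by (rule eventually_mono[OF eventually_at_right_less]) (use Y in fastforce)
  ultimately show ?thesis by (rule Lim_transform_eventually)
qed

text \<open>The second difference is symmetric in \<open>v\<close> and \<open>w\<close>, so both second derivatives are the limit of the
  same quotient.\<close>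

lemma second_differential_commute:
  fixes f :: "'a::euclidean_space \<Rightarrow> real"
  assumes "smooth_map f"
  shows "differential (\<lambda>y. differential f y v) x w = differential (\<lambda>y. differential f y w) x v"
proof -
  have lim: "((\<lambda>h. (f (x + h *\<^sub>R v + h *\<^sub>R w) - f (x + h *\<^sub>R v) - f (x + h *\<^sub>R w) + f x) / h\<^sup>2)
    \<longlongrightarrow> differential (\<lambda>y. differential f y v) x w) (at_right 0)" for v w
    using assms by (intro second_difference_quotient_tendsto smooth_map_differentiable
      smooth_map_isCont smooth_map_differential)
  show ?thesis
    using lim[of v w] lim[of w v] by (intro tendsto_unique[OF trivial_limit_at_right_real])
      (auto simp: algebra_simps)
qed

section \<open>The Jacobi identity\<close>

lemma differential_eq_gradient:
  assumes "f differentiable (at x)" shows "differential f x v = gradient f x \<bullet> v"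
proof -
  have lin: "linear (differential f x)"
    using has_derivative_differential[OF assms] by (rule has_derivative_linear)
  have "differential f x v = differential f x (\<Sum>i\<in>UNIV. v $ i *\<^sub>R axis i 1)"
    by (simp add: basis_expansion scalar_mult_eq_scaleR[symmetric])
  also have "\<dots> = (\<Sum>i\<in>UNIV. v $ i * differential f x (axis i 1))"
    by (simp add: linear_sum[OF lin] linear_cmul[OF lin])
  finally show ?thesis by (simp add: gradient_def inner_vec_def mult.commute)
qed

lemma gradient_eqI:
  assumes "(f has_derivative (\<lambda>v. g \<bullet> v)) (at x)" shows "gradient f x = g"
  by (simp add: gradient_def differential_eqI[OF assms] inner_axis vec_eq_iff)

lemma gradient_differentiable:
  assumes "smooth_map f" shows "gradient f differentiable (at x)"
proof -
  have "(gradient f has_derivative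
      (\<lambda>v. \<chi> i. differential (\<lambda>y. differential f y (axis i 1)) x v)) (at x)"
    using assms by (intro has_derivative_vecI) (simp add: gradient_def has_derivative_differential
      smooth_map_differentiable smooth_map_differential)
  then show ?thesis by (auto simp: differentiable_def)
qed

text \<open>The derivative of the gradient is the Hessian regarded as an endomorphism. In this form its symmetry
  combines with inner products, with no index sums.\<close>

lemma hessian_commute:
  assumes "smooth_map f"
  shows "differential (gradient f) x v \<bullet> w = differential (gradient f) x w \<bullet> v"
proof -
  have "differential (\<lambda>y. differential f y w) x v = differential (gradient f) x v \<bullet> w" for v w
  proof -
    have "((\<lambda>y. gradient f y \<bullet> w) has_derivative (\<lambda>v. differential (gradient f) x v \<bullet> w)) (at x)"
      using has_derivative_differential[OF gradient_differentiable[OF assms]]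
      by (auto intro!: derivative_eq_intros)
    moreover have "(\<lambda>y. differential f y w) = (\<lambda>y. gradient f y \<bullet> w)"
      using differential_eq_gradient[OF smooth_map_differentiable[OF assms]] by blast
    ultimately show ?thesis by (simp add: differential_eqI)
  qed
  then show ?thesis using second_differential_commute[OF assms] by metis
qed

lemma bounded_bilinear_matrix_vector_mult:
  "bounded_bilinear ((*v) :: real^'n^'m \<Rightarrow> real^'n \<Rightarrow> real^'m)"
  unfolding bilinear_conv_bounded_bilinear[symmetric] bilinear_def
  by (auto intro!: linearI simp: matrix_vector_right_distrib matrix_vector_mult_add_rdistrib
    matrix_vector_mult_scaleR scaleR_matrix_vector_assoc[symmetric])

lemma poisson_bracket_has_derivative:
  assumes \<pi>: "smooth_map \<pi>" and g: "smooth_map g" and h: "smooth_map h"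
  shows "(poisson_bracket \<pi> g h has_derivative (\<lambda>v.
    differential (gradient g) u v \<bullet> (\<pi> u *v gradient h u)
    + gradient g u \<bullet> (differential \<pi> u v *v gradient h u)
    + gradient g u \<bullet> (\<pi> u *v differential (gradient h) u v))) (at u)"
proof -
  note [derivative_intros] =
    has_derivative_differential[OF smooth_map_differentiable[OF \<pi>]]
    has_derivative_differential[OF gradient_differentiable[OF g]]
    has_derivative_differential[OF gradient_differentiable[OF h]]
    bounded_bilinear.FDERIV[OF bounded_bilinear_matrix_vector_mult]
  show ?thesis unfolding poisson_bracket_def[abs_def]
    by (rule derivative_eq_intros | rule refl)+ (auto simp: algebra_simps)
qed

text \<open>Skewness turns \<open>{f, K}\<close> into \<open>- dK(V\<^sub>f)\<close> with \<open>V\<^sub>f = \<pi> \<nabla>f\<close>, whence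
  \<open>{f, {g, h}} = D\<^sup>2h(V\<^sub>f, V\<^sub>g) - D\<^sup>2g(V\<^sub>f, V\<^sub>h) - \<nabla>g \<bullet> d\<pi>(V\<^sub>f) \<nabla>h\<close>.
  In the cyclic sum each Hessian occurs twice, with opposite signs and exchanged arguments. What is left
  is the cyclic hypothesis with \<open>a, b, c\<close> the gradients of \<open>f, g, h\<close>.\<close>

lemma poisson_structureI:
  fixes \<pi> :: "real^'n \<Rightarrow> real^'n^'n"
  assumes \<pi>: "smooth_map \<pi>" and anti: "\<And>u. transpose (\<pi> u) = - \<pi> u"
    and cyc: "\<And>u a b c. b \<bullet> (differential \<pi> u (\<pi> u *v a) *v c)
      + c \<bullet> (differential \<pi> u (\<pi> u *v b) *v a)
      + a \<bullet> (differential \<pi> u (\<pi> u *v c) *v b) = 0"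
  shows "poisson_structure \<pi>"
proof -
  have skew: "a \<bullet> (\<pi> u *v b) = - (b \<bullet> (\<pi> u *v a))" for u a b
  proof -
    have "a \<bullet> (\<pi> u *v b) = (transpose (\<pi> u) *v a) \<bullet> b"
      by (simp add: dot_lmul_matrix transpose_matrix_vector)
    also have "\<dots> = - (b \<bullet> (\<pi> u *v a))"
      using matrix_vector_mult_diff_rdistrib[of 0 "\<pi> u" a] by (simp add: anti inner_commute)
    finally show ?thesis .
  qed
  have double: "poisson_bracket \<pi> f (poisson_bracket \<pi> g h) u =
      differential (gradient h) u (\<pi> u *v gradient f u) \<bullet> (\<pi> u *v gradient g u)
      - differential (gradient g) u (\<pi> u *v gradient f u) \<bullet> (\<pi> u *v gradient h u)
      - gradient g u \<bullet> (differential \<pi> u (\<pi> u *v gradient f u) *v gradient h u)"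
    if f: "smooth_map f" and g: "smooth_map g" and h: "smooth_map h" for f g h u
  proof -
    let ?K = "poisson_bracket \<pi> g h"
    note D = poisson_bracket_has_derivative[OF \<pi> g h, of u]
    have "poisson_bracket \<pi> f ?K u = - (gradient ?K u \<bullet> (\<pi> u *v gradient f u))"
      by (subst poisson_bracket_def) (rule skew)
    also have "gradient ?K u \<bullet> (\<pi> u *v gradient f u) = differential ?K u (\<pi> u *v gradient f u)"
      using D by (intro differential_eq_gradient[symmetric]) (auto simp: differentiable_def)
    finally show ?thesis
      by (simp add: differential_eqI[OF D] skew[of "gradient g u"])
  qed
  show ?thesis unfolding poisson_structure_def
  proof (intro conjI allI impI)
    fix f g h :: "real^'n \<Rightarrow> real" and u
    assume f: "smooth_map f" and g: "smooth_map g" and h: "smooth_map h"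
    show "poisson_bracket \<pi> f (poisson_bracket \<pi> g h) u
          + poisson_bracket \<pi> g (poisson_bracket \<pi> h f) u
          + poisson_bracket \<pi> h (poisson_bracket \<pi> f g) u = 0"
      using cyc[of "gradient g u" u "gradient f u" "gradient h u"]
        hessian_commute[OF f] hessian_commute[OF g] hessian_commute[OF h]
      by (simp add: double f g h)
  qed (use \<pi> anti in auto)
qed


section \<open>Canonical Hamiltonian mechanics\<close>

lemma canonical_form_eq:
  "canonical_form x v w = (v $ 4 * w $ 1 - w $ 4 * v $ 1) + (v $ 5 * w $ 2 - w $ 5 * v $ 2)
    + (v $ 6 * w $ 3 - w $ 6 * v $ 3)"
proof -
  have "differential (\<lambda>y::real^6. y $ i) x = (\<lambda>v. v $ i)" for i x
    by (intro differential_eqI bounded_linear_imp_has_derivative bounded_linear_vec_nth)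
  then show ?thesis by (simp add: canonical_form_def wedge_def)
qed

lemma symplectic_canonical_form: "symplectic_form canonical_form"
  unfolding symplectic_form_def
proof (intro conjI allI impI)
  show "bilinear (canonical_form x)" for x
    unfolding bilinear_def
    by (auto intro!: linearI simp: canonical_form_eq algebra_simps)
  show "v = 0" if "\<forall>w. canonical_form x v w = 0" for x v
  proof -
    \<comment> \<open>Pairing with the basis vector of \<open>q\<^sub>i\<close> reads off the \<open>p\<^sub>i\<close>-component of \<open>v\<close>, and conversely.\<close>
    have "canonical_form x v (axis i 1) = 0" for i using that by blast
    from this[of 1] this[of 2] this[of 3] this[of 4] this[of 5] this[of 6]
    show ?thesis by (simp add: canonical_form_eq axis_def vec_eq_iff forall_6)
  qed
  show "ext_deriv canonical_form x u v w = 0" for x u v w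
    by (simp add: ext_deriv_def canonical_form_eq differential_eqI[OF has_derivative_const])
qed (simp_all add: canonical_form_eq smooth_map_const)

text \<open>Nondegeneracy makes the definite description meaningful: two solutions differ by a vector in the
  kernel of the form.\<close>

lemma hamiltonian_vector_field_unique:
  assumes "symplectic_form \<omega>" and X: "\<And>v. \<omega> x X v = - differential F x v"
  shows "hamiltonian_vector_field \<omega> F x = X"
  unfolding hamiltonian_vector_field_def
proof (rule the_equality)
  show "\<forall>v. \<omega> x X v = - differential F x v" using X by blast
next
  fix Y assume Y: "\<forall>v. \<omega> x Y v = - differential F x v"
  have "bilinear (\<omega> x)" using assms by (simp add: symplectic_form_def)
  then have "\<omega> x (Y - X) v = 0" for v using X Y by (simp add: bilinear_lsub)
  then have "Y - X = 0" using assms unfolding symplectic_form_def by blast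
  then show "Y = X" by simp
qed

text \<open>These are Hamilton's equations: the first three entries are the derivatives by the momenta, the last
  three the negated derivatives by the positions.\<close>

lemma hamiltonian_vector_field_canonical:
  assumes "F differentiable (at x)"
  shows "hamiltonian_vector_field canonical_form F x = (let d = gradient F x in
    vector [d $ 4, d $ 5, d $ 6, - d $ 1, - d $ 2, - d $ 3])"
  by (rule hamiltonian_vector_field_unique[OF symplectic_canonical_form])
     (simp add: Let_def canonical_form_eq differential_eq_gradient[OF assms] inner_vec_def sum_6 algebra_simps)

lemma symplectic_bracket_canonical:
  assumes F: "F differentiable (at x)"
  shows "symplectic_bracket canonical_form F G x =
    differential F x (hamiltonian_vector_field canonical_form G x)"
  unfolding symplectic_bracket_def hamiltonian_vector_field_canonical[OF F]
    differential_eq_gradient[OF F]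
  by (simp add: Let_def canonical_form_eq inner_vec_def sum_6 algebra_simps)

section \<open>The realization map\<close>

definition realization_map :: "real^6 \<Rightarrow> real^5" where
  "realization_map x = vector [x $ 1, x $ 4, x $ 2, x $ 5, x $ 6 - ((x $ 1)\<^sup>2 + (x $ 2)\<^sup>2) / 2]"

definition realization_map_deriv :: "real^6 \<Rightarrow> real^6 \<Rightarrow> real^5" where
  "realization_map_deriv x v =
    vector [v $ 1, v $ 4, v $ 2, v $ 5, v $ 6 - (x $ 1 * v $ 1 + x $ 2 * v $ 2)]"

lemma realization_map_has_derivative:
  "(realization_map has_derivative realization_map_deriv x) (at x)"
  unfolding realization_map_def[abs_def] realization_map_deriv_def[abs_def]
  by (intro has_derivative_vector_5)
     (auto intro!: derivative_eq_intros has_derivative_vec_nth simp: algebra_simps)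

lemma smooth_realization_map: "smooth_map realization_map"
proof (rule smooth_mapI[OF realization_map_has_derivative])
  fix v
  have "((\<lambda>x. realization_map_deriv x v) has_derivative
      (\<lambda>w. vector [0, 0, 0, 0, - (w $ 1 * v $ 1 + w $ 2 * v $ 2)])) (at x)" for x
    unfolding realization_map_deriv_def
    by (intro has_derivative_vector_5) (auto intro!: derivative_eq_intros has_derivative_vec_nth)
  then show "smooth_map (\<lambda>x. realization_map_deriv x v)"
    by (rule smooth_mapI) (rule smooth_map_const)
qed

text \<open>The fibres are lines in direction \<open>q\<^sub>3\<close>; the right inverse picks \<open>q\<^sub>3 = 0\<close> and solves for \<open>p\<^sub>3\<close>. The
  differential gets a right inverse in the same way, by taking the \<open>q\<^sub>3\<close>-component of the vector to be \<open>0\<close>.\<close>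

lemma surj_realization_map: "surj realization_map"
proof (rule surjI)
  show "realization_map (vector [u $ 1, u $ 3, 0, u $ 2, u $ 4, u $ 5 + ((u $ 1)\<^sup>2 + (u $ 3)\<^sup>2) / 2]) = u" for u
    by (simp add: realization_map_def vec_eq_iff forall_5)
qed

lemma submersion_realization_map: "submersion realization_map"
proof -
  have "surj (realization_map_deriv x)" for x
  proof (rule surjI)
    show "realization_map_deriv x
      (vector [u $ 1, u $ 3, 0, u $ 2, u $ 4, u $ 5 + (x $ 1 * u $ 1 + x $ 2 * u $ 3)]) = u" for u
      by (simp add: realization_map_deriv_def vec_eq_iff forall_5)
  qed
  then show ?thesis
    by (simp add: submersion_def smooth_realization_map differential_eqI[OF realization_map_has_derivative])
qed

section \<open>The Poisson structure\<close>

definition pi_matrix :: "real^5 \<Rightarrow> real^5^5" where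
  "pi_matrix u = vector
    [vector [ 0,      1,  0,      0,     0],
     vector [-1,      0,  0,      0, u $ 1],
     vector [ 0,      0,  0,      1,     0],
     vector [ 0,      0, -1,      0, u $ 3],
     vector [ 0, -u $ 1,  0, -u $ 3,     0]]"

lemma pi_matrix_mult:
  "pi_matrix u *v a = vector [a $ 2, u $ 1 * a $ 5 - a $ 1, a $ 4, u $ 3 * a $ 5 - a $ 3,
    - u $ 1 * a $ 2 - u $ 3 * a $ 4]"
  by (simp add: pi_matrix_def vec_eq_iff forall_5 matrix_vector_mult_def sum_5)

definition pi_matrix_deriv :: "real^5 \<Rightarrow> real^5^5" where
  "pi_matrix_deriv v = vector
    [vector [ 0,      0,  0,      0,     0],
     vector [ 0,      0,  0,      0, v $ 1],
     vector [ 0,      0,  0,      0,     0],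
     vector [ 0,      0,  0,      0, v $ 3],
     vector [ 0, -v $ 1,  0, -v $ 3,     0]]"

lemma pi_matrix_has_derivative: "(pi_matrix has_derivative pi_matrix_deriv) (at u)"
  unfolding pi_matrix_def[abs_def] pi_matrix_deriv_def[abs_def]
  by (intro has_derivative_vector_5 has_derivative_const has_derivative_minus has_derivative_vec_nth)

lemma poisson_structure_pi_matrix: "poisson_structure pi_matrix"
proof (rule poisson_structureI)
  show "smooth_map pi_matrix"
    by (rule smooth_mapI[OF pi_matrix_has_derivative smooth_map_const])
  show "transpose (pi_matrix u) = - pi_matrix u" for u
    by (simp add: pi_matrix_def transpose_def vec_eq_iff forall_5)
  (* Since pi u a has first and third entries a2 and a4, the cyclic sum consists of two determinants of
     (a, b, c), with rows 2, 2, 5 and 4, 4, 5; the repeated row makes both vanish. *)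
  have "pi_matrix_deriv v *v a = vector [0, v $ 1 * a $ 5, 0, v $ 3 * a $ 5,
      - v $ 1 * a $ 2 - v $ 3 * a $ 4]" for v a
    by (simp add: pi_matrix_deriv_def vec_eq_iff forall_5 matrix_vector_mult_def sum_5)
  then show "b \<bullet> (differential pi_matrix u (pi_matrix u *v a) *v c)
      + c \<bullet> (differential pi_matrix u (pi_matrix u *v b) *v a)
      + a \<bullet> (differential pi_matrix u (pi_matrix u *v c) *v b) = 0" for u a b c
    by (simp add: differential_eqI[OF pi_matrix_has_derivative] pi_matrix_mult
      inner_vec_def sum_5 algebra_simps)
qed

section \<open>The realization map is Poisson and relates the dynamics\<close>

lemma pullback_has_derivative:
  assumes "f differentiable (at (realization_map x))"
  shows "(f \<circ> realization_map has_derivative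
    (\<lambda>v. gradient f (realization_map x) \<bullet> realization_map_deriv x v)) (at x)"
  using diff_chain_at[OF realization_map_has_derivative has_derivative_differential[OF assms]]
  by (simp add: o_def differential_eq_gradient[OF assms])

text \<open>This gives the explicit Hamiltonian vector field of the theorem when \<open>f\<close> is \<open>H\<close>. The last entry is
  zero since \<open>q\<^sub>3\<close> is a cyclic coordinate of every pullback.\<close>

lemma hamiltonian_vector_field_pullback:
  assumes "f differentiable (at (realization_map x))"
  shows "hamiltonian_vector_field canonical_form (f \<circ> realization_map) x =
    (let g = gradient f (realization_map x) in
      vector [g $ 2, g $ 4, g $ 5, x $ 1 * g $ 5 - g $ 1, x $ 2 * g $ 5 - g $ 3, 0])"
proof -
  note D = pullback_has_derivative[OF assms]
  have grad: "gradient (f \<circ> realization_map) x $ i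
      = gradient f (realization_map x) \<bullet> realization_map_deriv x (axis i 1)" for i
    by (simp add: gradient_def differential_eqI[OF D])
  have "f \<circ> realization_map differentiable (at x)"
    using D by (auto simp: differentiable_def)
  from hamiltonian_vector_field_canonical[OF this] show ?thesis
    by (simp add: Let_def grad realization_map_deriv_def axis_def inner_vec_def sum_5 mult.commute)
qed

text \<open>Equivalently \<open>d\<phi> J d\<phi>\<^sup>T = \<pi> \<circ> \<phi>\<close> for the canonical Poisson matrix \<open>J\<close>, which is the infinitesimal form of
  the Poisson property.\<close>

lemma realization_map_hamiltonian:
  assumes "f differentiable (at (realization_map x))"
  shows "realization_map_deriv x (hamiltonian_vector_field canonical_form (f \<circ> realization_map) x)
    = poisson_vector_field pi_matrix f (realization_map x)"
  by (simp add: hamiltonian_vector_field_pullback[OF assms] Let_def poisson_vector_field_def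
    pi_matrix_mult realization_map_deriv_def realization_map_def vec_eq_iff forall_5)

text \<open>Both sides are \<open>\<nabla>f \<bullet> d\<phi>(X)\<close> for the canonical Hamiltonian vector field \<open>X\<close> of \<open>g \<circ> \<phi>\<close>, evaluated by
  the previous lemma.\<close>

lemma realization_map_poisson:
  assumes f: "f differentiable (at (realization_map x))"
    and g: "g differentiable (at (realization_map x))"
  shows "symplectic_bracket canonical_form (f \<circ> realization_map) (g \<circ> realization_map) x
    = poisson_bracket pi_matrix f g (realization_map x)"
proof -
  note D = pullback_has_derivative[OF f]
  have "f \<circ> realization_map differentiable (at x)"
    using D by (auto simp: differentiable_def)
  from symplectic_bracket_canonical[OF this] show ?thesis
    by (simp add: differential_eqI[OF D] realization_map_hamiltonian[OF g] poisson_bracket_def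
      poisson_vector_field_def)
qed

section \<open>Symplectic realization\<close>

theorem theorem2p1:
  fixes \<pi> :: "real^5 \<Rightarrow> real^5^5" and H :: "real^5 \<Rightarrow> real" and Ht :: "real^6 \<Rightarrow> real"
  assumes \<pi>: "\<And>x1 y1 x2 y2 z. \<pi> (vector [x1, y1, x2, y2, z]) =
      vector [vector [ 0,   1,  0,   0,  0],
              vector [-1,   0,  0,   0, x1],
              vector [ 0,   0,  0,   1,  0],
              vector [ 0,   0, -1,   0, x2],
              vector [ 0, -x1,  0, -x2,  0]]"
    and H: "\<And>x1 y1 x2 y2 z. H (vector [x1, y1, x2, y2, z]) = 1/2 * (y1^2 + y2^2 + z^2)"
    and Ht: "\<And>q1 q2 q3 p1 p2 p3. Ht (vector [q1, q2, q3, p1, p2, p3]) =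
      1/2 * p1^2 + 1/2 * p2^2 + 1/2 * (p3 - 1/2 * (q1^2 + q2^2))^2"
  shows "(\<forall>x1 y1 x2 y2 z. poisson_vector_field \<pi> H (vector [x1, y1, x2, y2, z]) =
      vector [y1, x1 * z, y2, x2 * z, - x1 * y1 - x2 * y2])
    \<and> (\<forall>q1 q2 q3 p1 p2 p3.
      hamiltonian_vector_field canonical_form Ht (vector [q1, q2, q3, p1, p2, p3]) =
      vector [p1, p2, p3 - 1/2 * (q1^2 + q2^2),
              q1 * p3 - 1/2 * q1^3 - 1/2 * q1 * q2^2,
              q2 * p3 - 1/2 * q1^2 * q2 - 1/2 * q2^3,
              0])
    \<and> full_symplectic_realization canonical_form (hamiltonian_vector_field canonical_form Ht)
           \<pi> (poisson_vector_field \<pi> H)"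
proof -
  have vec5: "u = vector [u $ 1, u $ 2, u $ 3, u $ 4, u $ 5]" for u :: "real^5"
    by (simp add: vec_eq_iff forall_5)
  have vec6: "x = vector [x $ 1, x $ 2, x $ 3, x $ 4, x $ 5, x $ 6]" for x :: "real^6"
    by (simp add: vec_eq_iff forall_6)
  have \<pi>_eq: "\<pi> = pi_matrix"
    by (rule ext, subst vec5, simp only: \<pi>) (simp add: pi_matrix_def)
  have H_eq: "H = (\<lambda>u. 1/2 * ((u $ 2)\<^sup>2 + (u $ 4)\<^sup>2 + (u $ 5)\<^sup>2))"
    by (rule ext, subst vec5, simp only: H)
  have lift: "Ht = H \<circ> realization_map"
    by (rule ext, subst vec6, simp only: Ht) (simp add: H_eq realization_map_def)
  have DH: "(H has_derivative (\<lambda>v. vector [0, u $ 2, 0, u $ 4, u $ 5] \<bullet> v)) (at u)" for u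
    unfolding H_eq by (auto intro!: derivative_eq_intros bounded_linear_imp_has_derivative
      bounded_linear_vec_nth simp: inner_vec_def sum_5 algebra_simps)
  have H_diff: "H differentiable (at u)" for u
    using DH by (auto simp: differentiable_def)
  have "poisson_vector_field \<pi> H (vector [x1, y1, x2, y2, z]) =
      vector [y1, x1 * z, y2, x2 * z, - x1 * y1 - x2 * y2]" for x1 y1 x2 y2 z
    by (simp add: poisson_vector_field_def \<pi>_eq pi_matrix_mult gradient_eqI[OF DH])
  moreover have "hamiltonian_vector_field canonical_form Ht (vector [q1, q2, q3, p1, p2, p3]) =
      vector [p1, p2, p3 - 1/2 * (q1^2 + q2^2),
              q1 * p3 - 1/2 * q1^3 - 1/2 * q1 * q2^2,
              q2 * p3 - 1/2 * q1^2 * q2 - 1/2 * q2^3,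
              0]" for q1 q2 q3 p1 p2 p3
    unfolding lift hamiltonian_vector_field_pullback[OF H_diff]
    by (simp add: gradient_eqI[OF DH] Let_def realization_map_def vec_eq_iff forall_6
      power2_eq_square power3_eq_cube algebra_simps)
  moreover have "full_symplectic_realization canonical_form
      (hamiltonian_vector_field canonical_form Ht) \<pi> (poisson_vector_field \<pi> H)"
    unfolding full_symplectic_realization_def \<pi>_eq
  proof (intro conjI exI[of _ realization_map] allI impI)
    show "symplectic_bracket canonical_form (f \<circ> realization_map) (g \<circ> realization_map) =
        poisson_bracket pi_matrix f g \<circ> realization_map" if "smooth_map f" "smooth_map g" for f g
      using that by (auto simp: realization_map_poisson smooth_map_differentiable)
    show "differential realization_map x (hamiltonian_vector_field canonical_form Ht x) =
        poisson_vector_field pi_matrix H (realization_map x)" for x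
      by (simp add: differential_eqI[OF realization_map_has_derivative] lift
        realization_map_hamiltonian[OF H_diff])
  qed (fact symplectic_canonical_form poisson_structure_pi_matrix submersion_realization_map
      surj_realization_map)+
  ultimately show ?thesis by blast
qed

end
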